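(* Fix an integer $k>1$ and let $h:[0,1]\to\mathbb{R}$ be a continuous strictly concave function which is six times differentiable on $(0,1)$. Assume that $h'(0^+)=\infty$, $h'(1^-)>-\infty$, and $h^{(3)}>0$, $h^{(4)}<0$, $h^{(6)}<0$ pointwise on $(0,1)$. Let $1\le\rho\le k$, and for $A=(a_{ij})\in\mathcal{S}_k(\rho)$ define $$H(A)=\sum_{i=1}^k\sum_{j=1}^k h(a_{ij}).$$ Then, for every $A\in\mathcal{S}_k(\rho)$, $$H(A)\le \max\left\{ m k\, h\left(\frac1k\right)+(k-m)\, f\left(\frac{k\rho-m}{k(k-m)}\right) :\ 0\le m\le \frac{k(k-\rho)}{k-1}\right\},$$ where $m$ ranges over real numbers.
   Context: $\mathcal{S}_k(\rho)$ is the set of all $k\times k$ row-stochastic matrices $A=(a_{ij})$ (nonnegative real entries, each row summing to $1$) with $\|A\|_2^2=\sum_{i,j}a_{ij}^2=\rho$. For $\frac1k\le r\le 1$ put $$x_r=\frac{1+\sqrt{(k-1)(kr-1)}}{k},\qquad y_r=\frac{1-x_r}{k-1},$$ and define $f:[1/k,1]\to\mathbb{R}$ by $f(r)=h(x_r)+(k-1)\,h(y_r)$. In the degenerate case $\rho=1$, $m=k$, the term $(k-m)f\left(\frac{k\rho-m}{k(k-m)}\right)$ is interpreted as $0$. $h'(0^+)$ and $h'(1^-)$ denote the one-sided limits of $h'$ at $0$ and $1$. *)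

theory Defs
  imports "HOL-Analysis.Analysis"
begin

definition strictly_concave_on :: "'a::real_vector set \<Rightarrow> ('a \<Rightarrow> real) \<Rightarrow> bool" where
  "strictly_concave_on S h \<longleftrightarrow> convex S \<and>
     (\<forall>x\<in>S. \<forall>y\<in>S. \<forall>t. x \<noteq> y \<and> 0 < t \<and> t < 1 \<longrightarrow>
        (1 - t) * h x + t * h y < h ((1 - t) *\<^sub>R x + t *\<^sub>R y))"

(* For i < n the i-th derivative exists and is differentiable at every point of S.
   S is meant to be open, so that deriv only depends on h on S. *)
definition times_differentiable_on :: "nat \<Rightarrow> real set \<Rightarrow> (real \<Rightarrow> real) \<Rightarrow> bool" where
  "times_differentiable_on n S h \<longleftrightarrow>
     (\<forall>i<n. \<forall>x\<in>S. (deriv ^^ i) h differentiable (at x))"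

definition row_stochastic :: "real^'n^'n \<Rightarrow> bool" where
  "row_stochastic A \<longleftrightarrow>
     (\<forall>i j. 0 \<le> A $ i $ j) \<and> (\<forall>i. (\<Sum>j\<in>UNIV. A $ i $ j) = 1)"

definition stochastic_of_norm :: "real \<Rightarrow> (real^'n^'n) set" where
  "stochastic_of_norm \<rho> =
     {A. row_stochastic A \<and> (\<Sum>i\<in>UNIV. \<Sum>j\<in>UNIV. (A $ i $ j)\<^sup>2) = \<rho>}"

definition entry_sum :: "(real \<Rightarrow> real) \<Rightarrow> real^'n^'n \<Rightarrow> real" where
  "entry_sum h A = (\<Sum>i\<in>UNIV. \<Sum>j\<in>UNIV. h (A $ i $ j))"

definition large_entry :: "nat \<Rightarrow> real \<Rightarrow> real" where
  "large_entry k r = (1 + sqrt ((real k - 1) * (real k * r - 1))) / real k"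

definition small_entry :: "nat \<Rightarrow> real \<Rightarrow> real" where
  "small_entry k r = (1 - large_entry k r) / (real k - 1)"

(* Only meaningful for 1 / k \<le> r \<le> 1, where both entries lie in [0, 1]. *)
definition row_value :: "nat \<Rightarrow> (real \<Rightarrow> real) \<Rightarrow> real \<Rightarrow> real" where
  "row_value k h r = h (large_entry k r) + (real k - 1) * h (small_entry k r)"

(* The second summand is 0 by convention at m = k. For m in the range
   0 \<le> m \<le> k (k - \<rho>) / (k - 1), this only happens when \<rho> = 1. *)
definition mixed_value :: "nat \<Rightarrow> (real \<Rightarrow> real) \<Rightarrow> real \<Rightarrow> real \<Rightarrow> real" where
  "mixed_value k h \<rho> m =
     m * real k * h (1 / real k) +
     (if m = real k then 0
      else (real k - m) * row_value k h ((real k * \<rho> - m) / (real k * (real k - m))))"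

end

(* Each row: a maximiser of the sum of h over the rows with given sum and sum of squares exists by
   compactness. Since h' is strictly convex, any three entries p >= q > z could be moved, keeping both
   constraints, so as to increase the sum; hence all entries but the largest agree, and the maximum
   is f(r).

   Combining rows: f'(r) = (h'(x) - h'(y)) / (2 (x - y)) with x = x_r, y = y_r is a mean of h'' and is
   concave as a function of the gap x - y because h'' is, so f' is quasiconcave in r. Therefore f has,
   at rho / k, a supporting line from above whose value there is a convex combination of f(1/k) and
   f(t) for some t >= rho / k. Summing the line over the rows bounds H(A) by the mixed value with m = k w,
   where w is the weight of f(1/k); the same line shows that this m is a maximiser. *)

theory Submission
  imports Defs
begin

section \<open>A single row with prescribed sum and sum of squares\<close>

text \<open>The expression is (p - q) (q - z) times the difference of the slopes of
  \<open>h1\<close> over [q, p] and [z, q]. By the mean value theorem these slopes are values of the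
  increasing function \<open>h2\<close> at points separated by q.\<close>

lemma strict_convex_deriv_three_points:
  fixes h1 h2 h3 :: "real \<Rightarrow> real"
  assumes h2: "\<And>x. x \<in> {0<..<1} \<Longrightarrow> (h1 has_real_derivative h2 x) (at x)"
    and h3: "\<And>x. x \<in> {0<..<1} \<Longrightarrow> (h2 has_real_derivative h3 x) (at x)"
    and pos: "\<And>x. x \<in> {0<..<1} \<Longrightarrow> 0 < h3 x"
    and ord: "0 < z" "z < q" "q < p" "p < 1"
  shows "0 < h1 p * (q - z) - h1 q * (p - z) + h1 z * (p - q)"
proof -
  obtain u where u: "z < u" "u < q" "h1 q - h1 z = (q - z) * h2 u"
    using MVT2[of z q h1 h2] h2 ord by force
  obtain v where v: "q < v" "v < p" "h1 p - h1 q = (p - q) * h2 v"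
    using MVT2[of q p h1 h2] h2 ord by force
  have "h2 u < h2 v"
  proof (rule DERIV_pos_imp_increasing[where f = h2])
    show "u < v" using u v by simp
    show "\<exists>y. (h2 has_real_derivative y) (at x) \<and> 0 < y" if "u \<le> x" "x \<le> v" for x
      using h3[of x] pos[of x] that u v ord by auto
  qed
  have "h1 p * (q - z) - h1 q * (p - z) + h1 z * (p - q)
      = (h1 p - h1 q) * (q - z) - (h1 q - h1 z) * (p - q)"
    by algebra
  also have "\<dots> = (p - q) * (q - z) * (h2 v - h2 u)"
    using u(3) v(3) by algebra
  also have "\<dots> > 0" using ord \<open>h2 u < h2 v\<close> by simp
  finally show ?thesis .
qed

text \<open>Along the circle of triples with prescribed sum and sum of squares, parametrised by the
  largest entry, the derivative of the sum of the \<open>h\<close>-values is a positive multiple of the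
  strict convexity defect of \<open>h1\<close> at the three entries.\<close>

lemma three_entries_improvement:
  fixes h h1 h2 h3 :: "real \<Rightarrow> real"
  assumes cont: "continuous_on {0..1} h"
    and h1: "\<And>x. x \<in> {0<..<1} \<Longrightarrow> (h has_real_derivative h1 x) (at x)"
    and h2: "\<And>x. x \<in> {0<..<1} \<Longrightarrow> (h1 has_real_derivative h2 x) (at x)"
    and h3: "\<And>x. x \<in> {0<..<1} \<Longrightarrow> (h2 has_real_derivative h3 x) (at x)"
    and pos: "\<And>x. x \<in> {0<..<1} \<Longrightarrow> 0 < h3 x"
    and ord: "0 \<le> z" "z < q" "q \<le> p" and le1: "p + q + z \<le> 1"
  obtains p' q' z' where "0 \<le> p'" "0 \<le> q'" "0 \<le> z'" "p' + q' + z' = p + q + z"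
    "p'\<^sup>2 + q'\<^sup>2 + z'\<^sup>2 = p\<^sup>2 + q\<^sup>2 + z\<^sup>2" "h p + h q + h z < h p' + h q' + h z'"
proof -
  define S where "S = p + q + z"
  \<comment> \<open>Once the largest entry is t, the other two have sum S - t and a prescribed sum
    of squares. They are (S - t)/2 plus and minus \<open>d t\<close>, where \<open>R t\<close> is
    the square of their difference.\<close>
  define R where "R t = 2 * (p\<^sup>2 + q\<^sup>2 + z\<^sup>2 - t\<^sup>2) - (S - t)\<^sup>2" for t
  define d where "d t = sqrt (R t) / 2" for t
  define Q where "Q t = (S - t) / 2 + d t" for t
  define Z where "Z t = (S - t) / 2 - d t" for t
  have Rp: "R p = (q - z)\<^sup>2" unfolding R_def S_def by algebra
  have dp: "d p = (q - z) / 2" unfolding d_def Rp using ord by simp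
  have Qp: "Q p = q" and Zp: "Z p = z"
    by (auto simp: Q_def Z_def dp S_def field_simps)
  \<comment> \<open>Because q > z, the discriminant is positive at p, so the curve continues for t
    slightly beyond p. The midpoint p' keeps it positive on a closed interval.\<close>
  have "isCont R p" unfolding R_def by (intro continuous_intros)
  moreover have "R p > 0" using Rp ord by simp
  ultimately have "eventually (\<lambda>t. R t > 0) (at p)"
    unfolding isCont_def by (rule order_tendstoD(1))
  then have "eventually (\<lambda>t. R t > 0) (at_right p)"
    by (simp add: eventually_at_split)
  then obtain b where b: "p < b" "\<And>t. p < t \<Longrightarrow> t < b \<Longrightarrow> R t > 0"
    unfolding eventually_at_right[OF less_add_one] by auto
  define p' where "p' = (p + b) / 2"
  have p': "p < p'" "p' < b" using b(1) by (auto simp: p'_def)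
  have Rpos: "R t > 0" if "p \<le> t" "t \<le> p'" for t
    using that b(2)[of t] \<open>R p > 0\<close> p' by (cases "t = p") auto
  have dpos: "d t > 0" if "p \<le> t" "t \<le> p'" for t
    using Rpos[OF that] by (simp add: d_def)
  have sqrtR: "sqrt (R t) = 2 * d t" for t by (simp add: d_def)
  have d_deriv: "(d has_real_derivative (S - 3 * t) / (4 * d t)) (at t)" if t: "p \<le> t" "t \<le> p'" for t
  proof -
    have "(R has_real_derivative 2 * S - 6 * t) (at t)"
      unfolding R_def by (auto intro!: derivative_eq_intros simp: algebra_simps)
    from DERIV_chain2[OF DERIV_real_sqrt[OF Rpos[OF t]] this]
    have "((\<lambda>t. sqrt (R t)) has_real_derivative inverse (sqrt (R t)) / 2 * (2 * S - 6 * t)) (at t)" .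
    then have "(d has_real_derivative inverse (sqrt (R t)) / 2 * (2 * S - 6 * t) / 2) (at t)"
      unfolding d_def by (intro DERIV_cdivide)
    moreover have "inverse (sqrt (R t)) / 2 * (2 * S - 6 * t) / 2 = (S - 3 * t) / (4 * d t)"
      unfolding sqrtR using dpos[OF t] by (simp add: field_simps)
    ultimately show ?thesis by metis
  qed
  have Q_deriv: "(Q has_real_derivative (Z t - t) / (2 * d t)) (at t)"
    and Z_deriv: "(Z has_real_derivative (t - Q t) / (2 * d t)) (at t)" if t: "p \<le> t" "t \<le> p'" for t
    unfolding Q_def[abs_def] Z_def[abs_def] using dpos[OF t]
    by (auto intro!: derivative_eq_intros d_deriv[OF t] simp: field_simps)
  have cont_QZ: "isCont Q t" "isCont Z t" if t: "p \<le> t" "t \<le> p'" for t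
    using DERIV_isCont[OF Q_deriv[OF t]] DERIV_isCont[OF Z_deriv[OF t]] by simp_all
  \<comment> \<open>Both summands of \<open>Q t\<close> decrease, so \<open>Q t\<close> < q \<le> p
    < t. Hence the order is strict for t > p even when p = q.\<close>
  have large: "Q t < t" if t: "p < t" "t \<le> p'" for t
  proof -
    have "R p - R t = (t - p) * (3 * (t + p) - 2 * S)"
      unfolding R_def by algebra
    moreover have "\<dots> > 0" using t ord by (simp add: S_def)
    ultimately have "d t < d p" by (simp add: d_def)
    then show ?thesis using dp ord t by (simp add: Q_def S_def field_simps)
  qed
  have small: "Z t < Q t" if "p \<le> t" "t \<le> p'" for t
    using dpos[OF that] by (simp add: Q_def Z_def)
  \<comment> \<open>The smallest entry may start at 0, where no derivative of \<open>h\<close> is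
    assumed. It increases strictly, so all three entries lie in (0, 1) as soon as t > p, and
    monotonicity up to p' follows from continuity at the ends.\<close>
  have Zpos: "0 < Z t" if t: "p < t" "t \<le> p'" for t
  proof -
    have "Z p < Z t"
    proof (rule DERIV_pos_imp_increasing_open[where f = Z])
      show "p < t" by fact
      show "\<exists>y. (Z has_real_derivative y) (at x) \<and> 0 < y" if "p < x" "x < t" for x
        using Z_deriv[of x] dpos[of x] large[of x] that t
        by (intro exI[of _ "(x - Q x) / (2 * d x)"] conjI divide_pos_pos) auto
      show "continuous_on {p..t} Z"
        using cont_QZ t by (intro continuous_at_imp_continuous_on) auto
    qed
    then show ?thesis using Zp ord by simp
  qed
  have total: "t + Q t + Z t = S" for t by (simp add: Q_def Z_def)
  have squares: "t\<^sup>2 + (Q t)\<^sup>2 + (Z t)\<^sup>2 = p\<^sup>2 + q\<^sup>2 + z\<^sup>2" if t: "p \<le> t" "t \<le> p'" for t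
  proof -
    have "(d t)\<^sup>2 * 4 = R t" using Rpos[OF t] by (simp add: d_def power_divide)
    moreover have "(Q t)\<^sup>2 + (Z t)\<^sup>2 = (S - t)\<^sup>2 / 2 + 2 * (d t)\<^sup>2"
      unfolding Q_def Z_def by (simp add: power2_eq_square field_simps)
    ultimately show ?thesis unfolding R_def by simp
  qed
  have range: "t \<in> {0..1} \<and> Q t \<in> {0..1} \<and> Z t \<in> {0..1}" if t: "p \<le> t" "t \<le> p'" for t
  proof -
    have "0 \<le> Z t" using Zpos[of t] Zp ord t by (cases "t = p") auto
    then show ?thesis using small[OF t] total[of t] le1 ord t by (auto simp: S_def)
  qed
  have "h p + h (Q p) + h (Z p) < h p' + h (Q p') + h (Z p')"
  proof (rule DERIV_pos_imp_increasing_open[where f = "\<lambda>t. h t + h (Q t) + h (Z t)"])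
    show "p < p'" by (fact p')
    fix t assume t: "p < t" "t < p'"
    have o: "0 < Z t" "Z t < Q t" "Q t < t" "t < 1"
      using Zpos[of t] small[of t] large[of t] total[of t] le1 t by (auto simp: S_def)
    note D = DERIV_chain2[OF h1 Q_deriv[of t]] DERIV_chain2[OF h1 Z_deriv[of t]] h1[of t]
    have "((\<lambda>t. h t + h (Q t) + h (Z t)) has_real_derivative
        h1 t + h1 (Q t) * ((Z t - t) / (2 * d t)) + h1 (Z t) * ((t - Q t) / (2 * d t))) (at t)"
      using o t by (intro DERIV_add D) auto
    moreover have "h1 t + h1 (Q t) * ((Z t - t) / (2 * d t)) + h1 (Z t) * ((t - Q t) / (2 * d t))
      = (h1 t * (Q t - Z t) - h1 (Q t) * (t - Z t) + h1 (Z t) * (t - Q t)) / (2 * d t)"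
    proof -
      have "Q t - Z t = 2 * d t" by (simp add: Q_def Z_def)
      then show ?thesis using dpos[of t] t by (simp add: field_simps)
    qed
    moreover have "\<dots> > 0"
      using strict_convex_deriv_three_points[OF h2 h3 pos o] dpos[of t] t by simp
    ultimately show "\<exists>y. ((\<lambda>t. h t + h (Q t) + h (Z t)) has_real_derivative y) (at t) \<and> 0 < y"
      by metis
  next
    have "continuous_on {p..p'} Q" "continuous_on {p..p'} Z"
      using cont_QZ by (intro continuous_at_imp_continuous_on; simp)+
    then show "continuous_on {p..p'} (\<lambda>t. h t + h (Q t) + h (Z t))"
      using range
      by (intro continuous_on_add continuous_on_compose2[OF cont] continuous_on_id) auto
  qed
  with range[of p'] squares[of p'] total[of p'] p' Qp Zp show thesis
    by (intro that[of p' "Q p'" "Z p'"]) (auto simp: S_def)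
qed

lemma row_sum_squares_bounds:
  fixes a :: "real^'n"
  assumes nn: "\<And>j. 0 \<le> a $ j" and one: "(\<Sum>j\<in>UNIV. a $ j) = 1"
  shows "1 / real CARD('n) \<le> (\<Sum>j\<in>UNIV. (a $ j)\<^sup>2)" "(\<Sum>j\<in>UNIV. (a $ j)\<^sup>2) \<le> 1"
proof -
  have "(\<Sum>j\<in>UNIV. a $ j * 1)\<^sup>2 \<le> (\<Sum>j\<in>UNIV. (a $ j)\<^sup>2) * (\<Sum>j\<in>(UNIV::'n set). 1\<^sup>2)"
    by (rule Cauchy_Schwarz_ineq_sum)
  then show "1 / real CARD('n) \<le> (\<Sum>j\<in>UNIV. (a $ j)\<^sup>2)"
    using one by (simp add: field_simps)
  have le1: "a $ j \<le> 1" for j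
    using member_le_sum[of j UNIV "\<lambda>j. a $ j"] nn one by simp
  have "(\<Sum>j\<in>UNIV. (a $ j)\<^sup>2) \<le> (\<Sum>j\<in>UNIV. a $ j)"
    using nn le1 by (intro sum_mono) (simp add: power2_eq_square mult_left_le)
  then show "(\<Sum>j\<in>UNIV. (a $ j)\<^sup>2) \<le> 1" using one by simp
qed

lemma row_bound:
  fixes h h1 h2 h3 :: "real \<Rightarrow> real" and a :: "real^'n"
  assumes cont: "continuous_on {0..1} h"
    and h1: "\<And>x. x \<in> {0<..<1} \<Longrightarrow> (h has_real_derivative h1 x) (at x)"
    and h2: "\<And>x. x \<in> {0<..<1} \<Longrightarrow> (h1 has_real_derivative h2 x) (at x)"
    and h3: "\<And>x. x \<in> {0<..<1} \<Longrightarrow> (h2 has_real_derivative h3 x) (at x)"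
    and pos: "\<And>x. x \<in> {0<..<1} \<Longrightarrow> 0 < h3 x"
    and k: "CARD('n) = k" "k > 1"
    and nn: "\<And>j. 0 \<le> a $ j" and one: "(\<Sum>j\<in>UNIV. a $ j) = 1"
  shows "(\<Sum>j\<in>UNIV. h (a $ j)) \<le> row_value k h (\<Sum>j\<in>UNIV. (a $ j)\<^sup>2)"
proof -
  define r where "r = (\<Sum>j\<in>UNIV. (a $ j)\<^sup>2)"
  define K where "K = {v::real^'n. (\<forall>j. 0 \<le> v $ j) \<and> (\<Sum>j\<in>UNIV. v $ j) = 1
                                   \<and> (\<Sum>j\<in>UNIV. (v $ j)\<^sup>2) = r}"
  have le1: "v $ j \<le> 1" if "v \<in> K" for v j
    using member_le_sum[of j UNIV "\<lambda>j. v $ j"] that by (auto simp: K_def)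
  have "closed K"
    unfolding K_def
    by (intro closed_Collect_conj closed_Collect_all closed_Collect_le closed_Collect_eq
          continuous_intros)
  moreover have "bounded K"
    unfolding bounded_iff by (rule exI[of _ "sqrt r"]) (auto simp: K_def norm_vec_def L2_set_def)
  ultimately have "compact K" using compact_eq_bounded_closed by blast
  moreover have aK: "a \<in> K" using nn one by (simp add: K_def r_def)
  moreover have "continuous_on K (\<lambda>v. \<Sum>j\<in>UNIV. h (v $ j))"
    by (intro continuous_on_sum continuous_on_compose2[OF cont] continuous_intros)
      (auto simp: le1, auto simp: K_def)
  ultimately obtain v where v: "v \<in> K"
    and vmax: "\<And>u. u \<in> K \<Longrightarrow> (\<Sum>j\<in>UNIV. h (u $ j)) \<le> (\<Sum>j\<in>UNIV. h (v $ j))"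
    using continuous_attains_sup[of K "\<lambda>v. \<Sum>j\<in>UNIV. h (v $ j)"] by blast
  have vnn: "0 \<le> v $ j" for j using v by (simp add: K_def)
  have no_two: "v $ l \<le> v $ m" if neq: "i \<noteq> l" "i \<noteq> m" "l \<noteq> m" and il: "v $ l \<le> v $ i" for i l m
  proof (rule ccontr)
    assume "\<not> v $ l \<le> v $ m"
    have split: "(\<Sum>j\<in>UNIV. F j) = F i + F l + F m + (\<Sum>j\<in>-{i,l,m}. F j)" for F :: "'n \<Rightarrow> real"
    proof -
      have "(\<Sum>j\<in>UNIV. F j) = (\<Sum>j\<in>{i,l,m}. F j) + (\<Sum>j\<in>-{i,l,m}. F j)"
        by (subst sum.union_disjoint[symmetric]) auto
      then show ?thesis using neq by simp
    qed
    have "0 \<le> (\<Sum>j\<in>-{i,l,m}. v $ j)" by (intro sum_nonneg vnn)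
    then have "v $ i + v $ l + v $ m \<le> 1"
      using v split[of "\<lambda>j. v $ j"] by (simp add: K_def)
    then obtain p q z where pqz: "0 \<le> p" "0 \<le> q" "0 \<le> z"
      "p + q + z = v $ i + v $ l + v $ m"
      "p\<^sup>2 + q\<^sup>2 + z\<^sup>2 = (v $ i)\<^sup>2 + (v $ l)\<^sup>2 + (v $ m)\<^sup>2"
      "h (v $ i) + h (v $ l) + h (v $ m) < h p + h q + h z"
      using three_entries_improvement[OF cont h1 h2 h3 pos, of "v $ m" "v $ l" "v $ i"]
        vnn il \<open>\<not> v $ l \<le> v $ m\<close> by (metis not_le)
    define u :: "real^'n" where
      "u = (\<chi> j. if j = i then p else if j = l then q else if j = m then z else v $ j)"
    have usum: "(\<Sum>j\<in>UNIV. F (u $ j)) = F p + F q + F z + (\<Sum>j\<in>-{i,l,m}. F (v $ j))"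
      for F :: "real \<Rightarrow> real"
    proof -
      have "(\<Sum>j\<in>-{i,l,m}. F (u $ j)) = (\<Sum>j\<in>-{i,l,m}. F (v $ j))"
        by (intro sum.cong) (auto simp: u_def)
      then show ?thesis using neq by (subst split) (auto simp: u_def)
    qed
    have "u \<in> K"
      using v pqz usum[of "\<lambda>x. x"] usum[of "\<lambda>x. x\<^sup>2"] split[of "\<lambda>j. v $ j"]
        split[of "\<lambda>j. (v $ j)\<^sup>2"]
      by (auto simp: K_def u_def)
    then show False
      using vmax[of u] usum[of h] split[of "\<lambda>j. h (v $ j)"] pqz(6) by simp
  qed
  obtain i where i: "\<And>j. v $ j \<le> v $ i"
  proof -
    have "Max (range (\<lambda>j. v $ j)) \<in> range (\<lambda>j. v $ j)" by (intro Max_in) auto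
    then obtain i where "Max (range (\<lambda>j. v $ j)) = v $ i" by blast
    then have "v $ j \<le> v $ i" for j using Max_ge[of "range (\<lambda>j. v $ j)" "v $ j"] by simp
    then show thesis by (rule that)
  qed
  obtain l where l: "l \<noteq> i"
    using k card_le_Suc0_iff_eq[of "UNIV::'n set"] by (metis finite UNIV_I One_nat_def not_less)
  define x y where "x = v $ i" and "y = v $ l"
  \<comment> \<open>With i the position of the largest entry, \<open>no_two\<close> applies to j and
    l in both orders.\<close>
  have vj: "v $ j = y" if "j \<noteq> i" for j
    using no_two[of i j l] no_two[of i l j] i that l unfolding y_def
    by (cases "j = l") (auto intro: antisym)
  have vsum: "(\<Sum>j\<in>UNIV. F (v $ j)) = F x + (real k - 1) * F y" for F :: "real \<Rightarrow> real"
  proof -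
    have "(\<Sum>j\<in>UNIV. F (v $ j)) = F x + (\<Sum>j\<in>UNIV-{i}. F (v $ j))"
      by (subst sum.remove[of _ i]) (auto simp: x_def)
    also have "(\<Sum>j\<in>UNIV-{i}. F (v $ j)) = (\<Sum>j\<in>UNIV-{i}. F y)"
      by (intro sum.cong) (auto simp: vj)
    also have "\<dots> = (real k - 1) * F y" using k by (simp add: card_Diff_singleton of_nat_diff)
    finally show ?thesis .
  qed
  have xy: "x + (real k - 1) * y = 1" "x\<^sup>2 + (real k - 1) * y\<^sup>2 = r"
    using v vsum[of "\<lambda>x. x"] vsum[of "\<lambda>x. x\<^sup>2"] by (auto simp: K_def)
  have kp: "real k - 1 > 0" using k by simp
  have "y \<le> x" using i by (simp add: x_def y_def)
  \<comment> \<open>The two constraints on x and y give a quadratic equation for x, and y \<le> x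
    selects the root with the nonnegative square root, which is \<open>large_entry\<close>.\<close>
  have "real k * x - 1 = (real k - 1) * (x - y)" using xy(1) by algebra
  moreover have "(real k - 1) * (real k * r - 1) = ((real k - 1) * (x - y))\<^sup>2"
    using xy by algebra
  moreover have "(real k - 1) * (x - y) \<ge> 0" using kp \<open>y \<le> x\<close> by simp
  ultimately have "sqrt ((real k - 1) * (real k * r - 1)) = real k * x - 1"
    by (metis real_sqrt_unique)
  then have "large_entry k r = x" using k by (simp add: large_entry_def)
  moreover from this have "small_entry k r = y"
    using xy(1) kp by (simp add: small_entry_def field_simps)
  ultimately have "(\<Sum>j\<in>UNIV. h (v $ j)) = row_value k h r"
    by (simp add: vsum row_value_def)
  then show ?thesis using vmax[OF aK] by (simp add: r_def)
qed

section \<open>Supporting lines and quasiconcave derivatives\<close>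

text \<open>A function with quasiconcave derivative is first convex and then concave. Its least
  concave majorant is a chord from the left end to a point of contact, followed by the graph itself.
  The point t is that contact point if c lies under the chord, and c itself (with w = 0)
  otherwise.\<close>

lemma quasiconcave_deriv_support:
  fixes f f' :: "real \<Rightarrow> real"
  assumes cont: "continuous_on {a..b} f"
    and f': "\<And>x. a < x \<Longrightarrow> x < b \<Longrightarrow> (f has_real_derivative f' x) (at x)"
    and qc: "\<And>u v w. a < u \<Longrightarrow> u < v \<Longrightarrow> v < w \<Longrightarrow> w < b \<Longrightarrow> min (f' u) (f' w) \<le> f' v"
    and c: "a < c" "c < b"
  obtains t w \<beta> where "c \<le> t" "t \<le> b" "0 \<le> w" "w < 1" "c = w * a + (1 - w) * t"
    "\<And>x. x \<in> {a..b} \<Longrightarrow> f x \<le> w * f a + (1 - w) * f t + \<beta> * (x - c)"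
proof -
  have mvt: "\<exists>u. x < u \<and> u < y \<and> f y - f x = (y - x) * f' u" if "a \<le> x" "x < y" "y \<le> b" for x y
  proof -
    have "continuous_on {x..y} f" using that by (intro continuous_on_subset[OF cont]) auto
    moreover have "(f has_derivative (\<lambda>h. h * f' u)) (at u)" if "x < u" "u < y" for u
      using f'[of u] that \<open>a \<le> x\<close> \<open>y \<le> b\<close>
      by (simp add: has_field_derivative_def mult.commute[of _ "f' u"])
    ultimately show ?thesis
      using mvt[of x y f "\<lambda>u h. h * f' u"] that by metis
  qed
  \<comment> \<open>The slope of the chord from the left end. Maximising over [c, b] avoids the
    singular point a; slopes to the left of c are settled by the case distinction.\<close>
  define s where "s x = (f x - f a) / (x - a)" for x
  have s_mult: "f x = f a + s x * (x - a)" if "a < x" for x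
    using that by (simp add: s_def)
  have "continuous_on {c..b} s"
    unfolding s_def using c by (intro continuous_intros continuous_on_subset[OF cont]) auto
  then obtain t where t: "t \<in> {c..b}" "\<And>x. x \<in> {c..b} \<Longrightarrow> s x \<le> s t"
    using continuous_attains_sup[of "{c..b}" s] c by auto
  show thesis
  proof (cases "\<forall>x\<in>{a<..<c}. s x \<le> s t")
    case True
    define w where "w = (t - c) / (t - a)"
    have ta: "t - a > 0" using t c by simp
    have w: "1 - w = (c - a) / (t - a)" using ta by (simp add: w_def field_simps)
    have val: "w * f a + (1 - w) * f t = f a + s t * (c - a)"
    proof -
      have "w * f a + (1 - w) * f t = f a + (1 - w) * (f t - f a)" by algebra
      then show ?thesis unfolding w s_def by simp
    qed
    show thesis
    proof (rule that[of t w "s t"])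
      show "c \<le> t" "t \<le> b" "0 \<le> w" using t ta by (auto simp: w_def)
      show "w < 1" using ta c by (simp add: w_def)
      have "(1 - w) * (t - a) = c - a" using ta by (simp add: w)
      then show "c = w * a + (1 - w) * t" by algebra
      fix x assume x: "x \<in> {a..b}"
      have "f x \<le> f a + s t * (x - a)"
      proof (cases "x = a")
        case False
        then have "s x \<le> s t" using True t(2)[of x] x by (cases "x < c") auto
        then show ?thesis using s_mult[of x] x False by (auto intro: mult_right_mono)
      qed simp
      then show "f x \<le> w * f a + (1 - w) * f t + s t * (x - c)"
        unfolding val by (simp add: algebra_simps)
    qed
  next
    case False
    \<comment> \<open>Some chord ending before c is steeper than every chord ending in [c, b], so
      \<open>f'\<close> has passed its peak by c. The tangent at c will be the supporting line; v
      records a point where \<open>f'\<close> is as large as s e.\<close>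
    then obtain e where e: "a < e" "e < c" "s t < s e" by auto
    then have sce: "s c < s e" using t(2)[of c] c by auto
    obtain v where v: "a < v" "v < e" "f e - f a = (e - a) * f' v"
      using mvt[of a e] e c by auto
    then have f'v: "f' v = s e" using e by (simp add: s_def)
    \<comment> \<open>Equivalently, f' c \<le> s c. Since the chord slope drops from s e to s c,
      \<open>f'\<close> falls below s c somewhere between e and c; with f' v = s e > s c,
      quasiconcavity keeps it from exceeding s c at c.\<close>
    have at_a: "f a \<le> f c + f' c * (a - c)"
    proof (rule ccontr)
      assume "\<not> ?thesis"
      then have "s c * (c - a) < f' c * (c - a)"
        using s_mult[OF c(1)] by (simp add: algebra_simps)
      then have 1: "s c < f' c" using c by simp
      obtain u where u: "e < u" "u < c" "f c - f e = (c - e) * f' u"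
        using mvt[of e c] e c by auto
      have "(c - e) * f' u = s c * (c - a) - s e * (e - a)"
        using u(3) s_mult[OF c(1)] s_mult[OF e(1)] by simp
      also have "\<dots> < s c * (c - a) - s c * (e - a)"
        using sce e by simp
      also have "\<dots> = (c - e) * s c" by algebra
      finally have "f' u < s c" using e by simp
      moreover have "min (f' v) (f' c) \<le> f' u" using qc[of v u c] v u c e by simp
      ultimately show False using 1 sce f'v by auto
    qed
    \<comment> \<open>A violation at x makes \<open>f'\<close> smaller than f' c somewhere in (x,
      c), hence everywhere before that point. Then \<open>f\<close> grows from a to x more slowly
      than the tangent, which already dominates at a.\<close>
    have left: "f x \<le> f c + f' c * (x - c)" if x: "a \<le> x" "x < c" for x
    proof (rule ccontr)
      assume neg: "\<not> ?thesis"
      then have "a < x" using at_a x by (cases "x = a") auto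
      obtain u where u: "x < u" "u < c" "f c - f x = (c - x) * f' u"
        using mvt[of x c] x c by auto
      have "(c - x) * f' u < (c - x) * f' c" using neg u(3) by (simp add: algebra_simps)
      then have uc: "f' u < f' c" using x by simp
      obtain y where y: "a < y" "y < x" "f x - f a = (x - a) * f' y"
        using mvt[of a x] x c \<open>a < x\<close> by auto
      have "min (f' y) (f' c) \<le> f' u" using qc[of y u c] u c y by simp
      then have "f' y < f' c" using uc by auto
      then have "f x - f a < (x - a) * f' c" using y(3) \<open>a < x\<close> by simp
      then show False using neg at_a by (simp add: algebra_simps)
    qed
    \<comment> \<open>A violation needs a slope above f' c beyond c. Quasiconcavity between v and
      that point gives s e \<le> f' c, contrary to f' c \<le> s c < s e.\<close>
    have right: "f x \<le> f c + f' c * (x - c)" if x: "c < x" "x \<le> b" for x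
    proof (rule ccontr)
      assume neg: "\<not> ?thesis"
      obtain u where u: "c < u" "u < x" "f x - f c = (x - c) * f' u"
        using mvt[of c x] x c by auto
      have "(x - c) * f' c < (x - c) * f' u" using neg u(3) by (simp add: algebra_simps)
      then have "f' c < f' u" using x by simp
      moreover have "min (f' v) (f' u) \<le> f' c" using qc[of v c u] v e u x by simp
      ultimately have "s e \<le> f' c" using f'v by auto
      moreover have "f' c * (c - a) \<le> s c * (c - a)"
        using at_a s_mult[OF c(1)] by (simp add: algebra_simps)
      ultimately show False using sce c by simp
    qed
    show thesis
    proof (rule that[of c 0 "f' c"])
      fix x assume "x \<in> {a..b}"
      then show "f x \<le> 0 * f a + (1 - 0) * f c + f' c * (x - c)"
        using left[of x] right[of x] by (cases x c rule: linorder_cases) auto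
    qed (use c in auto)
  qed
qed

text \<open>The quotient is the mean of \<open>h2\<close> over the interval from \<open>e - s e\<close> to \<open>e + s (1 - e)\<close>,
  i.e. the mean over \<open>t \<in> [0, 1]\<close> of \<open>h2 (e + s (t - e))\<close>, so it inherits concavity in \<open>s\<close>.\<close>

lemma mean_quasiconcave:
  fixes h1 h2 :: "real \<Rightarrow> real"
  assumes h2: "\<And>x. x \<in> {0<..<1} \<Longrightarrow> (h1 has_real_derivative h2 x) (at x)"
    and conc: "concave_on {0<..<1} h2"
    and e: "0 < e" "e < 1" and ord: "0 < u" "u < v" "v < w" "w < 1"
  defines "g \<equiv> \<lambda>s. (h1 (e + s * (1 - e)) - h1 (e - s * e)) / s"
  shows "min (g u) (g w) \<le> g v"
proof -
  define \<mu> where "\<mu> = (v - u) / (w - u)"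
  have \<mu>: "0 \<le> \<mu>" "\<mu> \<le> 1" using ord by (auto simp: \<mu>_def)
  have "\<mu> * (w - u) = v - u" using ord by (simp add: \<mu>_def)
  then have v_eq: "v = (1 - \<mu>) * u + \<mu> * w" by algebra
  have inside: "e + s * (t - e) \<in> {0<..<1}" if "0 < s" "s < 1" "0 \<le> t" "t \<le> 1" for s t
  proof -
    have "s * e < e" using e that by simp
    moreover have "s * t \<ge> 0" using that by simp
    moreover have "s * (t - e) \<le> s * (1 - e)" using that by simp
    moreover have "s * (1 - e) < 1 - e" using e that by simp
    ultimately show ?thesis by (auto simp: algebra_simps)
  qed
  \<comment> \<open>An antiderivative in t of h2 (e + s (t - e)), so the mean g s is the increment
    of \<open>P s\<close> over [0, 1]. Monotonicity of \<open>T\<close> then replaces integrating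
    the concavity inequality for \<open>h2\<close>.\<close>
  define P where "P s t = h1 (e + s * (t - e)) / s" for s t
  have P_deriv: "(P s has_real_derivative h2 (e + s * (t - e))) (at t)"
    if "0 < s" "s < 1" "0 \<le> t" "t \<le> 1" for s t
  proof -
    have "((\<lambda>t. e + s * (t - e)) has_real_derivative s) (at t)"
      by (auto intro!: derivative_eq_intros)
    from DERIV_cdivide[OF DERIV_chain2[OF h2[OF inside[OF that]] this], of s]
    show ?thesis unfolding P_def[abs_def] using that by simp
  qed
  define T where "T t = P v t - ((1 - \<mu>) * P u t + \<mu> * P w t)" for t
  have "T 0 \<le> T 1"
  proof (rule DERIV_nonneg_imp_nondecreasing[where f = T])
    fix t :: real assume t: "0 \<le> t" "t \<le> 1"
    let ?x = "\<lambda>s. e + s * (t - e)"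
    have "?x v = (1 - \<mu>) * ?x u + \<mu> * ?x w" unfolding v_eq by algebra
    moreover have "(1 - \<mu>) * h2 (?x u) + \<mu> * h2 (?x w) \<le> h2 ((1 - \<mu>) * ?x u + \<mu> * ?x w)"
      using concave_onD[OF conc \<mu>, of "?x u" "?x w"] inside[of u t] inside[of w t] ord t by simp
    moreover have "(T has_real_derivative
        h2 (?x v) - ((1 - \<mu>) * h2 (?x u) + \<mu> * h2 (?x w))) (at t)"
      unfolding T_def[abs_def] using ord t
      by (intro DERIV_diff DERIV_add DERIV_cmult P_deriv) auto
    ultimately show "\<exists>y. (T has_real_derivative y) (at t) \<and> 0 \<le> y"
      by (intro exI conjI) auto
  qed simp
  moreover have "g s = P s 1 - P s 0" for s
    by (simp add: g_def P_def diff_divide_distrib)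
  ultimately have "(1 - \<mu>) * g u + \<mu> * g w \<le> g v"
    by (simp only: T_def) (simp add: algebra_simps)
  moreover have "min (g u) (g w) \<le> (1 - \<mu>) * g u + \<mu> * g w"
  proof -
    have "(1 - \<mu>) * min (g u) (g w) + \<mu> * min (g u) (g w) \<le> (1 - \<mu>) * g u + \<mu> * g w"
      using \<mu> by (intro add_mono mult_left_mono) auto
    then show ?thesis by (simp add: algebra_simps)
  qed
  ultimately show ?thesis by simp
qed

section \<open>The row value in terms of the gap between its entries\<close>

text \<open>This is \<open>large_entry k r - small_entry k r\<close>, and also the weight of a unit
  vector when the row is written as a mixture of that vector and the uniform row. Both entries are
  affine in it.\<close>

definition entry_gap :: "nat \<Rightarrow> real \<Rightarrow> real" where
  "entry_gap k r = sqrt ((real k - 1) * (real k * r - 1)) / (real k - 1)"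

lemma entries_via_gap:
  assumes "k > 1"
  shows "large_entry k r = 1 / real k + entry_gap k r * (1 - 1 / real k)"
    and "small_entry k r = 1 / real k - entry_gap k r * (1 / real k)"
proof -
  have "real k - 1 > 0" "real k > 0" using assms by auto
  then show l: "large_entry k r = 1 / real k + entry_gap k r * (1 - 1 / real k)"
    by (simp add: large_entry_def entry_gap_def field_simps)
  have "1 - large_entry k r = (real k - 1) * (1 / real k - entry_gap k r * (1 / real k))"
    unfolding l using \<open>real k > 0\<close> by (simp add: field_simps)
  then show "small_entry k r = 1 / real k - entry_gap k r * (1 / real k)"
    using \<open>real k - 1 > 0\<close> unfolding small_entry_def by (metis nonzero_mult_div_cancel_left less_irrefl)
qed

text \<open>No bounds on r are required: \<open>sqrt\<close> is extended to negative arguments as an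
  odd function and is strictly increasing on all reals.\<close>

lemma entry_gap_strict_mono:
  assumes "k > 1" "r < r'"
  shows "entry_gap k r < entry_gap k r'"
  using assms by (simp add: entry_gap_def divide_strict_right_mono)

lemma entry_gap_ends:
  assumes "k > 1"
  shows "entry_gap k (1 / real k) = 0" "entry_gap k 1 = 1"
  using assms by (simp_all add: entry_gap_def)

lemma row_value_ends:
  assumes "k > 1"
  shows "row_value k h (1 / real k) = real k * h (1 / real k)"
  using assms by (simp add: row_value_def entries_via_gap entry_gap_ends algebra_simps)

lemma continuous_on_row_value:
  assumes "continuous_on {0..1} h" and k: "k > 1"
  shows "continuous_on {1 / real k..1} (row_value k h)"
proof -
  have gap: "entry_gap k r \<in> {0..1}" if "r \<in> {1 / real k..1}" for r
    using entry_gap_strict_mono[OF k, of "1 / real k" r] entry_gap_strict_mono[OF k, of r 1]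
      entry_gap_ends[OF k] that by force
  have c: "continuous_on A (entry_gap k)" for A
    unfolding entry_gap_def[abs_def] using k by (intro continuous_intros) auto
  have *: "1 / real k + s * (1 - 1 / real k) \<in> {0..1}" "1 / real k - s * (1 / real k) \<in> {0..1}"
    if "s \<in> {0..1}" for s
  proof -
    have "s * (1 - 1 / real k) \<le> 1 - 1 / real k" "s * (1 / real k) \<le> 1 / real k"
      "0 \<le> s * (1 - 1 / real k)" "0 \<le> s * (1 / real k)" "1 / real k \<ge> 0" "1 / real k \<le> 1"
      using that k by (auto intro!: mult_left_le_one_le mult_nonneg_nonneg simp: divide_right_mono)
    then show "1 / real k + s * (1 - 1 / real k) \<in> {0..1}" "1 / real k - s * (1 / real k) \<in> {0..1}"
      by auto
  qed
  show ?thesis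
    unfolding row_value_def[abs_def] entries_via_gap[OF k]
    by (intro continuous_intros continuous_on_compose2[OF assms(1)] c)
      (use * gap in blast)+
qed

text \<open>Differentiating x + (k - 1) y = 1 and x^2 + (k - 1) y^2 = r gives x' = 1 / (2 (x - y))
  and (k - 1) y' = -x'. The result is half the quotient in \<open>mean_quasiconcave\<close> with e =
  1/k.\<close>

lemma row_value_deriv:
  assumes h1: "\<And>x. x \<in> {0<..<1} \<Longrightarrow> (h has_real_derivative h1 x) (at x)"
    and k: "k > 1" and r: "1 / real k < r" "r < 1"
  shows "(row_value k h has_real_derivative
    (h1 (1 / real k + entry_gap k r * (1 - 1 / real k)) - h1 (1 / real k - entry_gap k r * (1 / real k)))
      / (2 * entry_gap k r)) (at r)"
proof -
  define s where "s = entry_gap k r"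
  define K where "K = real k"
  have K: "K > 1" using k by (simp add: K_def)
  have s: "0 < s" "s < 1"
    using entry_gap_strict_mono[OF k r(1)] entry_gap_strict_mono[OF k r(2)] entry_gap_ends[OF k]
    by (auto simp: s_def)
  have rad: "(K - 1) * (K * r - 1) > 0"
    using r K by (intro mult_pos_pos) (simp_all add: K_def field_simps)
  have "(entry_gap k has_real_derivative
      inverse (sqrt ((K - 1) * (K * r - 1))) / 2 * ((K - 1) * K) / (K - 1)) (at r)"
    unfolding entry_gap_def[abs_def] K_def[symmetric]
    by (intro DERIV_cdivide DERIV_chain2[where f = sqrt and x = r and g = "\<lambda>r. (K - 1) * (K * r - 1)",
          OF DERIV_real_sqrt[OF rad]])
      (auto intro!: derivative_eq_intros)
  moreover have "sqrt ((K - 1) * (K * r - 1)) = s * (K - 1)"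
    using K by (simp add: s_def entry_gap_def K_def)
  moreover have "inverse (s * (K - 1)) / 2 * ((K - 1) * K) / (K - 1) = K / (2 * s * (K - 1))"
  proof -
    have "inverse (s * L) / 2 * (L * K) / L = K / (2 * s * L)" if "L \<noteq> 0" for L
      using that s by (simp add: field_simps)
    from this[of "K - 1"] show ?thesis using K by (auto simp only:)
  qed
  ultimately have gd: "(entry_gap k has_real_derivative K / (2 * s * (K - 1))) (at r)"
    by (simp only:)
  have D1: "((\<lambda>r. 1 / K + entry_gap k r * (1 - 1 / K)) has_real_derivative 1 / (2 * s)) (at r)"
  proof -
    have "1 - 1 / K = (K - 1) / K" using K by (simp add: diff_divide_distrib)
    then have "K / (2 * s * (K - 1)) * (1 - 1 / K) = 1 / (2 * s)" using K by simp
    then show ?thesis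
      using DERIV_add[OF DERIV_const DERIV_cmult_right[OF gd, of "1 - 1 / K"], of "1 / K"] by simp
  qed
  have D2: "((\<lambda>r. 1 / K - entry_gap k r * (1 / K)) has_real_derivative - 1 / (2 * s * (K - 1))) (at r)"
    using DERIV_diff[OF DERIV_const DERIV_cmult_right[OF gd, of "1 / K"], of "1 / K"] K by simp
  have "s * (1 - 1 / K) < 1 - 1 / K" "s * (1 / K) < 1 / K"
    "0 < s * (1 - 1 / K)" "0 < s * (1 / K)" "1 / K > 0" "1 / K < 1"
    using s K by (auto simp: divide_strict_right_mono)
  then have in1: "1 / K + entry_gap k r * (1 - 1 / K) \<in> {0<..<1}"
    and in2: "1 / K - entry_gap k r * (1 / K) \<in> {0<..<1}"
    unfolding s_def[symmetric] greaterThanLessThan_iff by linarith+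
  have "(row_value k h has_real_derivative
     h1 (1 / K + entry_gap k r * (1 - 1 / K)) * (1 / (2 * s))
     + (K - 1) * (h1 (1 / K - entry_gap k r * (1 / K)) * (- 1 / (2 * s * (K - 1))))) (at r)"
    unfolding row_value_def[abs_def] entries_via_gap[OF k] K_def[symmetric]
    by (intro DERIV_add DERIV_cmult DERIV_chain2[OF h1[OF in1] D1] DERIV_chain2[OF h1[OF in2] D2])
  moreover have "X * (1 / (2 * s)) + (K - 1) * (Y * (- 1 / (2 * s * (K - 1)))) = (X - Y) / (2 * s)"
    for X Y using K s by (simp add: field_simps)
  ultimately show ?thesis unfolding K_def[symmetric] s_def[symmetric] by simp
qed

section \<open>Combining the rows of the matrix\<close>

theorem theorem9:
  fixes k :: nat and h :: "real \<Rightarrow> real" and \<rho> :: real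
  assumes "k > 1" and "CARD('n::finite) = k"
    and "continuous_on {0..1} h"
    and "strictly_concave_on {0..1} h"
    and "times_differentiable_on 6 {0<..<1} h"
    and "filterlim (deriv h) at_top (at_right 0)"
    and "\<exists>L. ((\<lambda>x. ereal (deriv h x)) \<longlongrightarrow> L) (at_left 1) \<and> L > -\<infinity>"
    and "\<And>x. 0 < x \<Longrightarrow> x < 1 \<Longrightarrow> (deriv ^^ 3) h x > 0"
    and "\<And>x. 0 < x \<Longrightarrow> x < 1 \<Longrightarrow> (deriv ^^ 4) h x < 0"
    and "\<And>x. 0 < x \<Longrightarrow> x < 1 \<Longrightarrow> (deriv ^^ 6) h x < 0"
    and "1 \<le> \<rho>" and "\<rho> \<le> real k"
  shows "\<exists>m. is_arg_max (mixed_value k h \<rho>)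
               (\<lambda>m. 0 \<le> m \<and> m \<le> real k * (real k - \<rho>) / (real k - 1)) m \<and>
             (\<forall>A \<in> (stochastic_of_norm \<rho> :: (real^'n^'n) set).
               entry_sum h A \<le> mixed_value k h \<rho> m)"
proof -
  define D where "D i = (deriv ^^ i) h" for i
  define f where "f = row_value k h"
  define a where "a = 1 / real k"
  note k = assms(1)
  have K: "real k > 1" using k by simp
  have a: "0 < a" "a < 1" "real k * a = 1" using K by (auto simp: a_def)
  have deriv: "(D i has_real_derivative D (Suc i) x) (at x)" if "i < 6" "x \<in> {0<..<1}" for i x
    using assms(5) that DERIV_deriv_iff_real_differentiable[of "D i" x]
    by (simp add: times_differentiable_on_def D_def)
  have D0: "D 0 = h" by (simp add: D_def)
  have deriv0: "(h has_real_derivative D 1 x) (at x)"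
    and deriv1: "(D 1 has_real_derivative D 2 x) (at x)"
    and deriv2: "(D 2 has_real_derivative D 3 x) (at x)"
    and deriv3: "(D 3 has_real_derivative D 4 x) (at x)" if "x \<in> {0<..<1}" for x
    using deriv[of 0 x] deriv[of 1 x] deriv[of 2 x] deriv[of 3 x] that D0
    by (simp_all add: numeral_eq_Suc)
  have D3: "D 3 x > 0" and D4: "D 4 x \<le> 0" if "x \<in> {0<..<1}" for x
    using assms(8)[of x] assms(9)[of x] that by (auto simp: D_def)
  have conc: "concave_on {0<..<1} (D 2)"
    by (rule f''_le0_imp_concave[OF _ deriv2 deriv3 D4]) auto
  define f' where "f' r = (D 1 (a + entry_gap k r * (1 - a)) - D 1 (a - entry_gap k r * a))
      / (2 * entry_gap k r)" for r
  have f': "(f has_real_derivative f' r) (at r)" if "a < r" "r < 1" for r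
    using row_value_deriv[OF deriv0 k, of r] that by (simp add: f_def f'_def a_def)
  have qc: "min (f' u) (f' w) \<le> f' v" if "a < u" "u < v" "v < w" "w < 1" for u v w
  proof -
    let ?s = "entry_gap k"
    have "0 < ?s u" "?s u < ?s v" "?s v < ?s w" "?s w < 1"
      using entry_gap_strict_mono[OF k] entry_gap_ends[OF k] that unfolding a_def by metis+
    from mean_quasiconcave[OF deriv1 conc a(1,2) this] show ?thesis
      by (simp add: f'_def min_def split: if_splits)
  qed
  have cont: "continuous_on {a..1} f"
    unfolding f_def a_def using continuous_on_row_value assms(3) k by blast
  have fa: "f a = real k * h (1 / real k)"
    unfolding f_def a_def by (rule row_value_ends[OF k])
  \<comment> \<open>At m = k the factor \<open>real k - m\<close> vanishes whatever \<open>f\<close>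
    is at the quotient by zero, so the convention needs no case distinction.\<close>
  have mixed: "mixed_value k h \<rho> m = m * f a + (real k - m) * f ((real k * \<rho> - m) / (real k * (real k - m)))"
    for m
    unfolding mixed_value_def fa by (simp add: f_def)
  let ?M = "real k * (real k - \<rho>) / (real k - 1)"
  define row where "row A i = (\<Sum>j\<in>UNIV. (A $ i $ j)\<^sup>2)" for A :: "real^'n^'n" and i
  have rows: "(\<forall>i. row A i \<in> {a..1}) \<and> (\<Sum>i\<in>UNIV. row A i) = \<rho>
      \<and> entry_sum h A \<le> (\<Sum>i\<in>UNIV. f (row A i))"
    if "A \<in> stochastic_of_norm \<rho>" for A :: "real^'n^'n"
  proof -
    have nn: "0 \<le> A $ i $ j" and one: "(\<Sum>j\<in>UNIV. A $ i $ j) = 1"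
      and nrm: "(\<Sum>i\<in>UNIV. row A i) = \<rho>" for i j
      using that by (auto simp: stochastic_of_norm_def row_stochastic_def row_def)
    have "row A i \<in> {a..1}" for i
      using row_sum_squares_bounds[of "A $ i", OF nn one] assms(2) by (simp add: row_def a_def)
    moreover have "entry_sum h A \<le> (\<Sum>i\<in>UNIV. f (row A i))"
      unfolding entry_sum_def f_def row_def
      by (intro sum_mono row_bound[OF assms(3) deriv0 deriv1 deriv2 D3 assms(2) k nn one]) auto
    ultimately show ?thesis using nrm by blast
  qed
  \<comment> \<open>From here on only the sums of squares of the rows matter: any k numbers in
    [1/k, 1] with total \<rho>.\<close>
  have reduce: ?thesis
    if m: "0 \<le> m" "m \<le> ?M"
      and max: "\<And>m'. 0 \<le> m' \<Longrightarrow> m' \<le> ?M \<Longrightarrow> mixed_value k h \<rho> m' \<le> mixed_value k h \<rho> m"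
      and bound: "\<And>r::'n \<Rightarrow> real. (\<And>i. r i \<in> {a..1}) \<Longrightarrow> (\<Sum>i\<in>UNIV. r i) = \<rho>
        \<Longrightarrow> (\<Sum>i\<in>UNIV. f (r i)) \<le> mixed_value k h \<rho> m" for m
  proof (intro exI[of _ m] conjI ballI)
    show "is_arg_max (mixed_value k h \<rho>) (\<lambda>m. 0 \<le> m \<and> m \<le> ?M) m"
      unfolding is_arg_max_def using m max by (meson not_le)
    show "entry_sum h A \<le> mixed_value k h \<rho> m" if "A \<in> stochastic_of_norm \<rho>" for A :: "real^'n^'n"
      using rows[OF that] bound[of "row A"] by (auto intro: order_trans)
  qed
  \<comment> \<open>The supporting line needs the mean \<rho> / k strictly inside (1/k, 1). At the
    two extremes every row is forced to be uniform or a unit vector, respectively.\<close>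
  consider "\<rho> = 1" | "\<rho> = real k" | "1 < \<rho>" "\<rho> < real k"
    using assms(11,12) by linarith
  then show ?thesis
  proof cases
    case 1
    have val: "mixed_value k h \<rho> m = real k * f a" for m
    proof (cases "m = real k")
      case False
      then have "(real k * \<rho> - m) / (real k * (real k - m)) = a"
        using 1 K by (simp add: a_def field_simps)
      then show ?thesis unfolding mixed by (simp add: algebra_simps)
    qed (simp add: mixed)
    show ?thesis
    proof (rule reduce[of 0])
      fix r :: "'n \<Rightarrow> real" assume r: "\<And>i. r i \<in> {a..1}" "(\<Sum>i\<in>UNIV. r i) = \<rho>"
      have "(\<Sum>i\<in>UNIV. r i - a) = 0"
        using r(2) 1 assms(2) a by (simp add: sum_subtractf)
      then have "r i = a" for i
        using r(1) by (subst (asm) sum_nonneg_eq_0_iff) auto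
      then show "(\<Sum>i\<in>UNIV. f (r i)) \<le> mixed_value k h \<rho> 0" using assms(2) by (simp add: val)
    next
      show "mixed_value k h \<rho> m' \<le> mixed_value k h \<rho> 0" for m' by (simp only: val)
    qed (use 1 K in auto)
  next
    case 2
    have val: "mixed_value k h \<rho> 0 = real k * f 1"
      unfolding mixed using 2 K by simp
    show ?thesis
    proof (rule reduce[of 0])
      fix r :: "'n \<Rightarrow> real" assume r: "\<And>i. r i \<in> {a..1}" "(\<Sum>i\<in>UNIV. r i) = \<rho>"
      have "(\<Sum>i\<in>UNIV. 1 - r i) = 0"
        using r(2) 2 assms(2) by (simp add: sum_subtractf)
      then have "r i = 1" for i
        using r(1) by (subst (asm) sum_nonneg_eq_0_iff) auto
      then show "(\<Sum>i\<in>UNIV. f (r i)) \<le> mixed_value k h \<rho> 0" using assms(2) by (simp add: val)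
    next
      fix m' assume "0 \<le> m'" "m' \<le> ?M"
      then have "m' = 0" using 2 by simp
      then show "mixed_value k h \<rho> m' \<le> mixed_value k h \<rho> 0" by simp
    qed (use 2 in auto)
  next
    case 3
    define c where "c = \<rho> / real k"
    have c: "a < c" "c < 1" using 3 K by (auto simp: a_def c_def divide_strict_right_mono)
    obtain t w \<beta> where t: "c \<le> t" "t \<le> 1" "0 \<le> w" "w < 1" "c = w * a + (1 - w) * t"
      and line: "\<And>x. x \<in> {a..1} \<Longrightarrow> f x \<le> w * f a + (1 - w) * f t + \<beta> * (x - c)"
      using quasiconcave_deriv_support[OF cont f' qc c] by blast
    define C where "C = w * f a + (1 - w) * f t"
    \<comment> \<open>Read m as a real number of rows at 1/k, the other k - m sharing the rest of
      \<rho> equally. The upper bound on m says exactly that this share is at most 1.\<close>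
    have arg: "(real k * \<rho> - m) / (real k * (real k - m)) \<in> {a..1}"
      "m * a + (real k - m) * ((real k * \<rho> - m) / (real k * (real k - m))) = \<rho>"
      if "0 \<le> m" "m \<le> ?M" "m < real k" for m
    proof -
      have "m * (real k - 1) \<le> real k * (real k - \<rho>)" using that K by (simp add: field_simps)
      moreover have "real k * (real k - m) > 0" using that K by simp
      ultimately show "(real k * \<rho> - m) / (real k * (real k - m)) \<in> {a..1}"
        using K 3 by (simp add: a_def field_simps)
      show "m * a + (real k - m) * ((real k * \<rho> - m) / (real k * (real k - m))) = \<rho>"
        using that K by (simp add: a_def field_simps)
    qed
    have M: "?M < real k" using 3 K by (simp add: field_simps)
    \<comment> \<open>For m = k w the share of the other rows is t, because c = w a + (1 - w) t. The
      mixed value is therefore k times the height of the line at c.\<close>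
    have eq: "mixed_value k h \<rho> (real k * w) = real k * C"
    proof -
      have "\<rho> = w + real k * ((1 - w) * t)"
        using t(5) a K unfolding c_def by (simp add: field_simps)
      then have "real k * \<rho> - real k * w = real k * (real k - real k * w) * t" by algebra
      moreover have "real k * (real k - real k * w) \<noteq> 0" using t K by simp
      ultimately have "(real k * \<rho> - real k * w) / (real k * (real k - real k * w)) = t" by simp
      then show ?thesis unfolding mixed C_def by (simp add: algebra_simps)
    qed
    show ?thesis
    proof (rule reduce[of "real k * w"])
      show "0 \<le> real k * w" using t by simp
      have "w * (1 - a) \<le> 1 - c"
      proof -
        have "(1 - w) * t \<le> 1 - w" using t by simp
        then have "c \<le> w * a + (1 - w)" using t(5) by simp
        then show ?thesis by (simp add: algebra_simps)
      qed
      then have "real k * (w * (1 - a)) \<le> real k * (1 - c)" using K by simp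
      moreover have "real k * (w * (1 - a)) = w * (real k - 1)" using a(3) by algebra
      moreover have "real k * (1 - c) = real k - \<rho>" using K by (simp add: c_def right_diff_distrib)
      ultimately have "w * (real k - 1) \<le> real k - \<rho>" by simp
      then show "real k * w \<le> ?M" using K by (simp add: pos_le_divide_eq mult.assoc)
    next
      fix m assume m: "0 \<le> m" "m \<le> ?M"
      then have mk: "m < real k" using M by simp
      let ?x = "(real k * \<rho> - m) / (real k * (real k - m))"
      \<comment> \<open>The line is applied at both points; since their weighted mean is c, the
        terms with \<beta> cancel.\<close>
      have "mixed_value k h \<rho> m \<le> m * (C + \<beta> * (a - c)) + (real k - m) * (C + \<beta> * (?x - c))"
        unfolding mixed C_def using line[of a] line[of ?x] arg(1)[OF m mk] a m mk
        by (intro add_mono mult_left_mono) auto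
      also have "\<dots> = real k * C + \<beta> * ((m * a + (real k - m) * ?x) - real k * c)" by algebra
      also have "\<dots> = real k * C" unfolding arg(2)[OF m mk] using K by (simp add: c_def)
      finally show "mixed_value k h \<rho> m \<le> mixed_value k h \<rho> (real k * w)" unfolding eq .
    next
      fix r :: "'n \<Rightarrow> real" assume r: "\<And>i. r i \<in> {a..1}" "(\<Sum>i\<in>UNIV. r i) = \<rho>"
      have "(\<Sum>i\<in>UNIV. f (r i)) \<le> (\<Sum>i\<in>UNIV. C + \<beta> * (r i - c))"
        unfolding C_def by (intro sum_mono line r)
      also have "\<dots> = real k * C + \<beta> * (\<rho> - real k * c)"
        using r(2) assms(2) by (simp add: sum.distrib sum_distrib_left[symmetric] sum_subtractf)
      also have "\<dots> = real k * C" using K by (simp add: c_def)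
      finally show "(\<Sum>i\<in>UNIV. f (r i)) \<le> mixed_value k h \<rho> (real k * w)" unfolding eq .
    qed
  qed
qed

end
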